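(* Let $n,k\ge 1$ and let ${\bf C}=(C_0,C_1,\dots,C_k)$ be a $(k+1)$-tuple of real $n\times n$ matrices such that $C_0$ is invertible and $C_0^{-1}C_i$ is a $Z$-matrix for every $i\in\{1,\dots,k\}$. Then the following statements are equivalent: (i) ${\bf C}$ has the column $W$-property. (ii) ${\bf C}$ has the $\mathbf{SSM}$-$W$ property.
   Context: Notation: $x*y$ is the Hadamard (componentwise) product of $x,y\in\mathbb{R}^n$; inequalities between vectors are componentwise. A real square matrix is a $Z$-matrix if all its off-diagonal entries are non-positive. Let ${\bf C}=(C_0,\dots,C_k)$ be a tuple of real $n\times n$ matrices. A matrix $R\in\mathbb{R}^{n\times n}$ is a column representative of ${\bf C}$ if for each $j\in\{1,\dots,n\}$ the $j$-th column of $R$ is the $j$-th column of one of $C_0,\dots,C_k$. ${\bf C}$ has the column $W$-property if the determinants of all column representatives of ${\bf C}$ are all positive or all negative. ${\bf C}$ has the $\mathbf{SSM}$-$W$ property if, for all $x_0,x_1,\dots,x_k\in\mathbb{R}^n$, the conditions $C_0x_0=\sum_{i=1}^kC_ix_i$, $x_i\ge 0$ and $x_0*x_i\le 0$ for all $i\in\{1,\dots,k\}$ imply $x_0=x_1=\dots=x_k=0$. (No sign condition is imposed on $x_0$.) *)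

theory Defs
  imports "HOL-Analysis.Analysis"
begin

text \<open>
  A tuple of matrices \<open>C\<^sub>0, \<dots>, C\<^sub>k\<close> is a function \<open>C\<close> on the natural numbers together with the
  bound \<open>k\<close>; the values of \<open>C\<close> beyond \<open>k\<close> are irrelevant. On vectors, \<open>*\<close> is the library's
  componentwise (Hadamard) product and \<open>\<le>\<close> is its componentwise order.
\<close>

definition Z_matrix :: "real^'n^'n \<Rightarrow> bool" where
  "Z_matrix A \<longleftrightarrow> (\<forall>i j. i \<noteq> j \<longrightarrow> A $ i $ j \<le> 0)"

definition column_representative ::
  "nat \<Rightarrow> (nat \<Rightarrow> real^'n^'n) \<Rightarrow> real^'n^'n \<Rightarrow> bool" where
  "column_representative k C R \<longleftrightarrow> (\<forall>j. \<exists>i\<in>{0..k}. column j R = column j (C i))"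

definition column_W_property :: "nat \<Rightarrow> (nat \<Rightarrow> real^'n^'n) \<Rightarrow> bool" where
  "column_W_property k C \<longleftrightarrow>
     (\<forall>R. column_representative k C R \<longrightarrow> det R > 0) \<or>
     (\<forall>R. column_representative k C R \<longrightarrow> det R < 0)"

definition SSM_W_property :: "nat \<Rightarrow> (nat \<Rightarrow> real^'n^'n) \<Rightarrow> bool" where
  "SSM_W_property k C \<longleftrightarrow>
     (\<forall>x :: nat \<Rightarrow> real^'n.
        C 0 *v x 0 = (\<Sum>i=1..k. C i *v x i) \<and>
        (\<forall>i\<in>{1..k}. 0 \<le> x i \<and> x 0 * x i \<le> 0)
        \<longrightarrow> (\<forall>i\<in>{0..k}. x i = 0))"

end

theory Submission
  imports Defs
begin

text \<open>
  If the \<open>W\<close>-property holds, then by multilinearity \<open>det\<close> keeps its sign on matrices whose columns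
  are nontrivial nonnegative combinations of the respective columns of the \<open>C\<^sub>i\<close>; a nonzero solution
  of the \<open>SSM\<close>-\<open>W\<close> system would give a singular matrix of this kind.
  Conversely, after multiplication by the inverse of \<open>C\<^sub>0\<close> a column representative is a \<open>Z\<close>-matrix \<open>N\<close>.
  If \<open>det N \<le> 0\<close>, some matrix on the segment from \<open>N\<close> to the identity is singular, and the
  componentwise absolute value \<open>u\<close> of a kernel vector satisfies \<open>N u \<le> 0\<close>; distributing the entries of
  \<open>u\<close> according to the origin of the columns of \<open>N\<close> contradicts the \<open>SSM\<close>-\<open>W\<close> property.
\<close>

text \<open>The library's \<open>det_linear_rows_sum\<close> forces the summation index to have the type of the rows.\<close>

lemma det_rows_sum:
  fixes b :: "'n::finite \<Rightarrow> 'i \<Rightarrow> 'a::comm_ring_1^'n"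
  assumes "finite I"
  shows "det (\<chi> j. \<Sum>i\<in>I. b j i) = (\<Sum>f | \<forall>j. f j \<in> I. det (\<chi> j. b j (f j)))"
proof -
  have F: "PiE UNIV (\<lambda>_. I) = {f :: 'n \<Rightarrow> 'i. \<forall>j. f j \<in> I}"
    by (auto simp: PiE_def)
  have "(\<Prod>j\<in>UNIV. \<Sum>i\<in>I. b j i $ p j) = (\<Sum>f | \<forall>j. f j \<in> I. \<Prod>j\<in>UNIV. b j (f j) $ p j)" for p
    unfolding F[symmetric] using assms by (intro prod_sum_PiE) auto
  then show ?thesis
    by (simp add: det_def sum_distrib_left) (rule sum.swap)
qed

text \<open>Multilinear expansion writes the determinant as a sum over choice functions
  \<open>f\<close>, each term weighted by a product of the \<open>w j (f j)\<close>. No term is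
  negative after scaling by \<open>c\<close>, and a choice of positive weights gives a positive one.
  The factor \<open>c\<close> lets both signs be treated at once.\<close>

lemma det_row_combinations_sign:
  fixes a :: "'n::finite \<Rightarrow> 'i \<Rightarrow> real^'n"
  assumes "finite I"
    and nonneg: "\<And>j i. i \<in> I \<Longrightarrow> 0 \<le> w j i"
    and pos: "\<And>j. \<exists>i\<in>I. 0 < w j i"
    and det: "\<And>f. (\<And>j. f j \<in> I) \<Longrightarrow> 0 < c * det (\<chi> j. a j (f j))"
  shows "0 < c * det (\<chi> j. \<Sum>i\<in>I. w j i *s a j i)"
proof -
  let ?F = "{f :: 'n \<Rightarrow> 'i. \<forall>j. f j \<in> I}"
  let ?g = "\<lambda>f. prod (\<lambda>j. w j (f j)) UNIV * (c * det (\<chi> j. a j (f j)))"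
  have "finite ?F"
    using finite_PiE[of "UNIV :: 'n set" "\<lambda>_. I"] \<open>finite I\<close> by (simp add: PiE_def Pi_def)
  have "c * det (\<chi> j. \<Sum>i\<in>I. w j i *s a j i) = (\<Sum>f\<in>?F. ?g f)"
    by (subst det_rows_sum[OF \<open>finite I\<close>]) (simp add: det_rows_mul sum_distrib_left mult_ac)
  moreover obtain f where f: "\<And>j. f j \<in> I" "\<And>j. 0 < w j (f j)"
    using pos by metis
  have "0 < (\<Sum>f\<in>?F. ?g f)"
  proof (rule sum_pos2[OF \<open>finite ?F\<close>])
    show "f \<in> ?F" using f by simp
    show "0 < ?g f"
      by (intro mult_pos_pos prod_pos det f)
    show "0 \<le> ?g h" if "h \<in> ?F" for h
      using that by (intro mult_nonneg_nonneg[OF prod_nonneg less_imp_le[OF det]] nonneg ballI) auto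
  qed
  ultimately show ?thesis by simp
qed

lemma det_column_combinations_nonzero:
  fixes C :: "nat \<Rightarrow> real^'n^'n"
  assumes W: "column_W_property k C"
    and nonneg: "\<And>j i. i \<le> k \<Longrightarrow> 0 \<le> w j i"
    and pos: "\<And>j. \<exists>i\<le>k. 0 < w j i"
    and Q: "\<And>j. column j Q = (\<Sum>i=0..k. w j i *s column j (C i))"
  shows "det Q \<noteq> 0"
proof -
  obtain c :: real where c: "\<And>R. column_representative k C R \<Longrightarrow> 0 < c * det R"
  proof -
    from W consider "\<forall>R. column_representative k C R \<longrightarrow> 0 < 1 * det R"
      | "\<forall>R. column_representative k C R \<longrightarrow> 0 < (-1) * det R"
      unfolding column_W_property_def by auto
    then show ?thesis using that by cases blast+
  qed
  have "0 < c * det (\<chi> j. \<Sum>i\<in>{0..k}. w j i *s column j (C i))"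
  proof (rule det_row_combinations_sign)
    fix f :: "'n \<Rightarrow> nat" assume f: "\<And>j. f j \<in> {0..k}"
    let ?R = "\<chi> j. column j (C (f j))"
    \<comment> \<open>The expansion works on rows, so the chosen columns were laid out as rows;
      transposing gives a column representative.\<close>
    have "column_representative k C (transpose ?R)"
      unfolding column_representative_def
    proof
      fix j
      have "column j (transpose ?R) = column j (C (f j))"
        by (simp add: vec_eq_iff column_def transpose_def)
      then show "\<exists>i\<in>{0..k}. column j (transpose ?R) = column j (C i)" using f by blast
    qed
    from c[OF this] show "0 < c * det ?R" by (simp add: det_transpose)
  next
    show "\<exists>i\<in>{0..k}. 0 < w j i" for j
      using pos[of j] by auto
  qed (use nonneg in auto)
  also have "(\<chi> j. \<Sum>i\<in>{0..k}. w j i *s column j (C i)) = transpose Q"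
    unfolding Q[symmetric] by (simp add: vec_eq_iff column_def transpose_def)
  finally show ?thesis by (auto simp: det_transpose)
qed

lemma column_W_imp_SSM_W:
  fixes C :: "nat \<Rightarrow> real^'n^'n"
  assumes W: "column_W_property k C"
  shows "SSM_W_property k C"
  unfolding SSM_W_property_def
proof (intro allI impI, elim conjE)
  fix x :: "nat \<Rightarrow> real^'n"
  assume eq: "C 0 *v x 0 = (\<Sum>i=1..k. C i *v x i)"
    and "\<forall>i\<in>{1..k}. 0 \<le> x i \<and> x 0 * x i \<le> 0"
  then have nonneg: "0 \<le> x i $ j" and compl: "x 0 $ j * x i $ j \<le> 0" if "i \<in> {1..k}" for i j
    using that by (auto simp: less_eq_vec_def)
  \<comment> \<open>Complementarity makes \<open>x 0\<close> nonpositive on \<open>J\<close>; off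
    \<open>J\<close> all \<open>x i\<close> with \<open>i \<ge> 1\<close> vanish, but
    \<open>x 0\<close> has arbitrary sign.\<close>
  define J where "J = {j. \<exists>i\<in>{1..k}. 0 < x i $ j}"
  have J: "x 0 $ j \<le> 0" if "j \<in> J" for j
    using that compl by (force simp: J_def mult_le_0_iff)
  have notJ: "x i $ j = 0" if "j \<notin> J" "i \<in> {1..k}" for i j
    using that nonneg[of i j] by (force simp: J_def)
  \<comment> \<open>The products \<open>w j i * y $ j\<close> must recover the entries of
    \<open>- x 0\<close> and \<open>x i\<close>. On \<open>J\<close> these entries are themselves
    valid weights; off \<open>J\<close> the column of \<open>C 0\<close> is taken and
    \<open>y\<close> absorbs the unsigned entry.\<close>
  define w where "w j i = (if j \<in> J then (if i = 0 then - x 0 $ j else x i $ j)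
                           else (if i = 0 then 1 else 0))" for j i
  define y where "y = (\<chi> j. if j \<in> J then 1 else - x 0 $ j)"
  define Q where "Q = (\<chi> l j. \<Sum>i=0..k. w j i * C i $ l $ j)"
  have "det Q \<noteq> 0"
  proof (rule det_column_combinations_nonzero[OF W])
    show "0 \<le> w j i" if "i \<le> k" for i j
      using that J nonneg by (auto simp: w_def)
    show "\<exists>i\<le>k. 0 < w j i" for j
    proof (cases "j \<in> J")
      case True
      then obtain i where "i \<in> {1..k}" "0 < x i $ j" by (auto simp: J_def)
      with True show ?thesis by (intro exI[of _ i]) (auto simp: w_def)
    next
      case False
      then show ?thesis by (intro exI[of _ 0]) (simp add: w_def)
    qed
    show "column j Q = (\<Sum>i=0..k. w j i *s column j (C i))" for j
      by (simp add: vec_eq_iff column_def Q_def)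
  qed
  have wy: "w j i * y $ j = (if i = 0 then - x 0 $ j else x i $ j)" if "i \<in> {0..k}" for i j
    using that notJ[of j i] by (auto simp: w_def y_def)
  have "Q *v y = (\<Sum>i=0..k. C i *v (if i = 0 then - x 0 else x i))"
  proof (rule vec_eq_iff[THEN iffD2], rule allI)
    fix l
    have "(Q *v y) $ l = (\<Sum>j\<in>UNIV. \<Sum>i=0..k. C i $ l $ j * (w j i * y $ j))"
      by (simp add: Q_def matrix_vector_mult_def sum_distrib_left sum_distrib_right mult_ac)
    also have "\<dots> = (\<Sum>i=0..k. \<Sum>j\<in>UNIV. C i $ l $ j * (if i = 0 then - x 0 $ j else x i $ j))"
      by (subst sum.swap) (simp add: wy)
    also have "\<dots> = (\<Sum>i=0..k. C i *v (if i = 0 then - x 0 else x i)) $ l"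
      by (auto simp: matrix_vector_mult_def intro!: sum.cong)
    finally show "(Q *v y) $ l = (\<Sum>i=0..k. C i *v (if i = 0 then - x 0 else x i)) $ l" .
  qed
  also have "\<dots> = - (C 0 *v x 0) + (\<Sum>i=1..k. C i *v x i)"
    by (simp add: sum.atLeast_Suc_atMost vec.neg)
  finally have "Q *v y = 0" using eq by simp
  with \<open>det Q \<noteq> 0\<close> have "y = 0"
    by (metis invertible_det_nz invertible_left_inverse matrix_left_invertible_ker)
  then have y: "y $ j = 0" for j by simp
  have "j \<notin> J" for j using y[of j] by (auto simp: y_def)
  then have "x 0 = 0" "\<forall>i\<in>{1..k}. x i = 0"
    using y notJ by (auto simp: y_def vec_eq_iff)
  then show "\<forall>i\<in>{0..k}. x i = 0"
    by (metis atLeastAtMost_iff less_one linorder_not_less)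
qed

lemma Z_matrix_det_nonpos_subsolution:
  fixes N :: "real^'n^'n"
  assumes Z: "Z_matrix N" and "det N \<le> 0"
  obtains u where "0 \<le> u" "u \<noteq> 0" "N *v u \<le> 0"
proof -
  let ?S = "\<lambda>t. (1 - t) *\<^sub>R N + t *\<^sub>R mat 1 :: real^'n^'n"
  have "continuous_on {0..1} (\<lambda>t. det (?S t))"
    unfolding det_def by (intro continuous_intros)
  \<comment> \<open>The determinant is nonpositive at 0 and equals 1 at 1, which also rules out
    \<open>t = 1\<close>.\<close>
  then obtain t where t: "0 \<le> t" "t \<le> 1" "det (?S t) = 0"
    using IVT'[of "\<lambda>t. det (?S t)" 0 0 1] \<open>det N \<le> 0\<close> by auto
  then have "t < 1" by (cases "t = 1") auto
  obtain y where y: "?S t *v y = 0" "y \<noteq> 0"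
    using t(3) by (metis invertible_det_nz invertible_left_inverse matrix_left_invertible_ker)
  let ?u = "\<chi> j. \<bar>y $ j\<bar>"
  have "(N *v ?u) $ l \<le> 0" for l
  proof -
    have off: "N $ l $ j \<le> 0" if "j \<noteq> l" for j
      using Z that by (auto simp: Z_matrix_def)
    let ?r = "\<Sum>j\<in>UNIV - {l}. N $ l $ j * y $ j"
    have split: "(N *v v) $ l = N $ l $ l * v $ l + (\<Sum>j\<in>UNIV - {l}. N $ l $ j * v $ j)" for v
      by (simp add: matrix_vector_mult_def sum.remove[of UNIV l])
    have "(?S t *v y) $ l = (1 - t) * (N *v y) $ l + t * y $ l"
      by (simp add: matrix_vector_mult_add_rdistrib scaleR_matrix_vector_assoc[symmetric])
    \<comment> \<open>Isolate the diagonal term in row \<open>l\<close>. After taking absolute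
      values, \<open>t \<ge> 0\<close> allows dropping \<open>t\<close>, and
      \<open>1 - t > 0\<close> cancels.\<close>
    with y(1) have "((1 - t) * N $ l $ l + t) * y $ l = - (1 - t) * ?r"
      by (simp add: split algebra_simps)
    then have "\<bar>(1 - t) * N $ l $ l + t\<bar> * \<bar>y $ l\<bar> = (1 - t) * \<bar>?r\<bar>"
      using \<open>t < 1\<close> by (simp flip: abs_mult) (simp add: abs_mult)
    moreover have "(1 - t) * N $ l $ l * \<bar>y $ l\<bar> \<le> \<bar>(1 - t) * N $ l $ l + t\<bar> * \<bar>y $ l\<bar>"
      using t by (intro mult_right_mono) auto
    ultimately have "(1 - t) * (N $ l $ l * \<bar>y $ l\<bar>) \<le> (1 - t) * \<bar>?r\<bar>" by simp
    then have "N $ l $ l * \<bar>y $ l\<bar> \<le> \<bar>?r\<bar>" using \<open>t < 1\<close> by simp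
    also have "\<bar>?r\<bar> \<le> (\<Sum>j\<in>UNIV - {l}. \<bar>N $ l $ j * y $ j\<bar>)" by (rule sum_abs)
    also have "\<dots> = - (\<Sum>j\<in>UNIV - {l}. N $ l $ j * \<bar>y $ j\<bar>)"
      using off by (auto simp: abs_mult sum_negf[symmetric] intro!: sum.cong)
    finally show ?thesis by (simp add: split)
  qed
  then show ?thesis
    using y(2) by (intro that[of ?u]) (auto simp: less_eq_vec_def vec_eq_iff)
qed

lemma SSM_W_imp_det_pos:
  fixes C :: "nat \<Rightarrow> real^'n^'n"
  assumes SSM: "SSM_W_property k C" and inv: "invertible (C 0)"
    and Z: "\<forall>i\<in>{1..k}. Z_matrix (matrix_inv (C 0) ** C i)"
    and R: "column_representative k C R"
  shows "0 < det (matrix_inv (C 0) ** R)"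
proof (rule ccontr)
  let ?A = "matrix_inv (C 0)"
  let ?N = "?A ** R"
  have A: "?A ** C 0 = mat 1" "C 0 ** ?A = mat 1"
    using someI_ex[OF inv[unfolded invertible_def]] by (simp_all add: matrix_inv_def)
  from R obtain f where f: "\<And>j. f j \<le> k" "\<And>j. column j R = column j (C (f j))"
    unfolding column_representative_def by (metis atLeastAtMost_iff)
  have Rf: "R $ l $ j = C (f j) $ l $ j" for l j
    using f(2)[of j] by (simp add: column_def vec_eq_iff)
  have Nf: "?N $ l $ j = (?A ** C (f j)) $ l $ j" for l j
    by (simp add: matrix_matrix_mult_def Rf)
  have "Z_matrix ?N"
    unfolding Z_matrix_def
  proof (intro allI impI)
    fix l j :: 'n assume "l \<noteq> j"
    show "?N $ l $ j \<le> 0"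
    proof (cases "f j = 0")
      \<comment> \<open>A column taken from \<open>C 0\<close> becomes a column of the
        identity.\<close>
      case True
      then show ?thesis using \<open>l \<noteq> j\<close> by (simp add: Nf A mat_def)
    next
      case False
      with f(1)[of j] have "f j \<in> {1..k}" by auto
      with Z \<open>l \<noteq> j\<close> show ?thesis by (simp add: Nf Z_matrix_def)
    qed
  qed
  moreover assume "\<not> 0 < det ?N"
  ultimately obtain u where u: "0 \<le> u" "u \<noteq> 0" "?N *v u \<le> 0"
    by (auto intro: Z_matrix_det_nonpos_subsolution[of ?N])
  \<comment> \<open>The \<open>z i\<close> split \<open>u\<close> by the origin of the columns of
    \<open>R\<close>, so \<open>R *v u\<close> is the sum of the \<open>C i *v z i\<close>. Moving
    the term for \<open>C 0\<close> to the left dictates \<open>x 0\<close>, which is nonpositive,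
    so complementarity is automatic.\<close>
  define z where "z i = (\<chi> j. if f j = i then u $ j else 0)" for i
  define x where "x i = (if i = 0 then ?N *v u - z 0 else z i)" for i
  have z: "0 \<le> z i" for i
    using u(1) by (simp add: z_def less_eq_vec_def)
  have "x 0 \<le> 0"
    using z[of 0] u(3) by (auto simp: x_def less_eq_vec_def intro: order_trans)
  have Ru: "R *v u = (\<Sum>i=0..k. C i *v z i)"
  proof (rule vec_eq_iff[THEN iffD2], rule allI)
    fix l
    have "(\<Sum>i=0..k. C i *v z i) $ l = (\<Sum>j\<in>UNIV. \<Sum>i=0..k. C i $ l $ j * z i $ j)"
      by (subst sum.swap) (simp add: matrix_vector_mult_def)
    also have "\<dots> = (\<Sum>j\<in>UNIV. \<Sum>i=0..k. if f j = i then C i $ l $ j * u $ j else 0)"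
      by (rule sum.cong[OF refl], rule sum.cong[OF refl]) (simp add: z_def)
    also have "\<dots> = (R *v u) $ l"
      by (simp add: f(1) matrix_vector_mult_def Rf)
    finally show "(R *v u) $ l = (\<Sum>i=0..k. C i *v z i) $ l" by simp
  qed
  have "C 0 *v x 0 = R *v u - C 0 *v z 0"
    by (simp add: x_def matrix_vector_mult_diff_distrib matrix_vector_mul_assoc
        matrix_mul_assoc A)
  also have "\<dots> = (\<Sum>i=1..k. C i *v x i)"
    by (simp add: Ru sum.atLeast_Suc_atMost x_def)
  finally have "C 0 *v x 0 = (\<Sum>i=1..k. C i *v x i)" .
  moreover have "0 \<le> x i \<and> x 0 * x i \<le> 0" if "i \<in> {1..k}" for i
    using that z[of i] \<open>x 0 \<le> 0\<close>
    by (auto simp: x_def less_eq_vec_def intro!: mult_nonpos_nonneg)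
  ultimately have x0: "x i = 0" if "i \<in> {0..k}" for i
    using SSM that unfolding SSM_W_property_def by blast
  \<comment> \<open>The vanishing of \<open>x 0\<close> does not directly give
    \<open>z 0 = 0\<close>: it is squeezed between 0 and \<open>?N *v u \<le> 0\<close>.\<close>
  have "z 0 = ?N *v u" using x0[of 0] by (simp add: x_def)
  then have "z 0 \<le> 0" using u(3) by (rule ord_eq_le_trans)
  then have "z 0 = 0" using z by (rule order_antisym)
  have "u $ j = 0" for j
  proof -
    have "z (f j) = 0"
      using x0[of "f j"] f(1)[of j] \<open>z 0 = 0\<close> by (cases "f j = 0") (auto simp: x_def)
    then have "z (f j) $ j = 0" by simp
    then show ?thesis by (simp add: z_def)
  qed
  with u(2) show False by (simp add: vec_eq_iff)
qed

theorem theorem4p7: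
  fixes C :: "nat \<Rightarrow> real^'n^'n" and k :: nat
  assumes "k \<ge> 1"
    and "invertible (C 0)"
    and "\<forall>i\<in>{1..k}. Z_matrix (matrix_inv (C 0) ** C i)"
  shows "column_W_property k C \<longleftrightarrow> SSM_W_property k C"
proof
  assume "SSM_W_property k C"
  \<comment> \<open>The first factor is independent of \<open>R\<close>, so its sign is shared by
    all representatives.\<close>
  then have pos: "0 < det (matrix_inv (C 0)) * det R" if "column_representative k C R" for R
    using SSM_W_imp_det_pos[OF _ assms(2,3) that] by (simp add: det_mul)
  show "column_W_property k C"
    unfolding column_W_property_def
    using pos by (cases "0 < det (matrix_inv (C 0))") (auto simp: zero_less_mult_iff)
qed (rule column_W_imp_SSM_W)

end
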